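(* Let $H$ be a non-bipartite graph on $h$ vertices and let $A_H$ be its adjacency matrix. (i) For each integer $k\in\mathbb{N}$ and any $\mathcal{A}\subseteq V(H)^k$, there is a subset $\mathcal{A}'\subseteq\mathcal{A}$ of size at most $\mathrm{mimsup}(H)^k$ that $A_H^{\otimes k}$-represents $\mathcal{A}$. (ii) Conversely, for each $\epsilon>0$ and each sufficiently large $k$, there is a set $\mathcal{A}\subseteq V(H)^k$ such that no $\mathcal{A}'\subseteq\mathcal{A}$ of size at most $(\mathrm{mimsup}(H)-\epsilon)^k$ $A_H^{\otimes k}$-represents $\mathcal{A}$.
   Context: $A_H^{\otimes k}$ denotes the $k$-fold Kronecker power of $A_H$; its rows and columns are indexed by $V(H)^k$, with $A_H^{\otimes k}[r,c]=\prod_{j=1}^k A_H[r_j,c_j]$. For a $0/1$ matrix $M$ with row index set $\mathcal{R}$ and $\mathcal{A}'\subseteq\mathcal{A}\subseteq\mathcal{R}$, we say $\mathcal{A}'$ $M$-represents $\mathcal{A}$ if for every column $j$: whenever there is $i\in\mathcal{A}$ with $M[i,j]=1$, there is also $i'\in\mathcal{A}'$ with $M[i',j]=1$. For a $0/1$ matrix $M$, $\mathrm{mim}(M)$ is the largest $r$ such that some $r$ distinct rows and $r$ distinct columns (in some order) form the $r\times r$ identity matrix, and $\mathrm{mimsup}(M)=\limsup_{k\to\infty}\mathrm{mim}(M^{\otimes k})^{1/k}$; for non-bipartite $H$, $\mathrm{mimsup}(H)=\mathrm{mimsup}(A_H)$.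
   Formalization: In (ii) the base mimsup(H)−ε is replaced by max(0, mimsup(H)−ε), since for ε ≥ 2·mimsup(H) and even k the bound as written is at least mimsup(H)^k, contradicting (i); for ε ≤ mimsup(H) nothing changes. *)

theory Defs
  imports
    "Graph_Theory.Pair_Digraph"
    "HOL-Library.Extended_Real"
    Complex_Main
begin

text \<open>
  Finite simple undirected graphs are instances of \<^locale>\<open>pair_graph\<close>: the vertex set and the
  arc relation are finite, and the arc relation is symmetric and loop-free.
\<close>

definition bipartite :: "'a pair_pre_digraph \<Rightarrow> bool" where
  "bipartite H \<longleftrightarrow>
    (\<exists>X Y. X \<union> Y = pverts H \<and> X \<inter> Y = {} \<and> parcs H \<subseteq> X \<times> Y \<union> Y \<times> X)"

text \<open>
  A 0/1 matrix is a function of a row index and a column index. Its index sets are passed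
  separately wherever they matter; entries outside them are irrelevant.
\<close>

definition adj_matrix :: "'a pair_pre_digraph \<Rightarrow> 'a \<Rightarrow> 'a \<Rightarrow> nat" where
  "adj_matrix H u v = (if (u, v) \<in> parcs H then 1 else 0)"

text \<open>The elements of \<open>S\<^sup>k\<close> are the lists of length \<open>k\<close> over \<open>S\<close>.\<close>

definition tuples :: "nat \<Rightarrow> 'a set \<Rightarrow> 'a list set" where
  "tuples k S = {xs. set xs \<subseteq> S \<and> length xs = k}"

definition kron_power :: "nat \<Rightarrow> ('r \<Rightarrow> 'c \<Rightarrow> nat) \<Rightarrow> 'r list \<Rightarrow> 'c list \<Rightarrow> nat" where
  "kron_power k M r c = (\<Prod>j<k. M (r ! j) (c ! j))"

text \<open>Here \<open>C\<close> is the set of column indices of \<open>M\<close>.\<close>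

definition represents :: "'c set \<Rightarrow> ('r \<Rightarrow> 'c \<Rightarrow> nat) \<Rightarrow> 'r set \<Rightarrow> 'r set \<Rightarrow> bool" where
  "represents C M A' A \<longleftrightarrow>
    A' \<subseteq> A \<and> (\<forall>j\<in>C. (\<exists>i\<in>A. M i j = 1) \<longrightarrow> (\<exists>i'\<in>A'. M i' j = 1))"

definition has_identity_submatrix ::
  "'r set \<Rightarrow> 'c set \<Rightarrow> ('r \<Rightarrow> 'c \<Rightarrow> nat) \<Rightarrow> nat \<Rightarrow> bool" where
  "has_identity_submatrix R C M n \<longleftrightarrow>
    (\<exists>row col. row ` {..<n} \<subseteq> R \<and> inj_on row {..<n} \<and> col ` {..<n} \<subseteq> C \<and> inj_on col {..<n} \<and>
      (\<forall>i<n. \<forall>j<n. M (row i) (col j) = (if i = j then 1 else 0)))"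

definition mim :: "'r set \<Rightarrow> 'c set \<Rightarrow> ('r \<Rightarrow> 'c \<Rightarrow> nat) \<Rightarrow> nat" where
  "mim R C M = Max {n. has_identity_submatrix R C M n}"

text \<open>
  The limit superior is taken in the extended reals, since \<^const>\<open>limsup\<close> needs a complete lattice.
  For finite index sets it is finite, so the conversion back to the reals loses nothing; this is
  the lemma \<open>ereal_mimsup\<close> below.
\<close>

definition mimsup :: "'r set \<Rightarrow> 'c set \<Rightarrow> ('r \<Rightarrow> 'c \<Rightarrow> nat) \<Rightarrow> real" where
  "mimsup R C M = real_of_ereal (limsup (\<lambda>k.
    ereal (real (mim (tuples k R) (tuples k C) (kron_power k M)) powr (1 / real k))))"

text \<open>This is the notion for non-bipartite graphs; it is not meant to be used for bipartite ones.\<close>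

definition graph_mimsup :: "'a pair_pre_digraph \<Rightarrow> real" where
  "graph_mimsup H = mimsup (pverts H) (pverts H) (adj_matrix H)"

lemma has_identity_submatrix_le:
  assumes "finite R" "has_identity_submatrix R C M n"
  shows "n \<le> card R"
proof -
  from assms(2) obtain row :: "nat \<Rightarrow> 'a" where "row ` {..<n} \<subseteq> R" "inj_on row {..<n}"
    unfolding has_identity_submatrix_def by blast
  then have "card {..<n} \<le> card R" using assms(1) card_inj_on_le by blast
  then show ?thesis by simp
qed

lemma mim_le:
  assumes "finite R"
  shows "mim R C M \<le> card R"
proof -
  let ?S = "{n. has_identity_submatrix R C M n}"
  have "?S \<subseteq> {..card R}" using has_identity_submatrix_le[OF assms] by auto
  then have fin: "finite ?S" by (rule finite_subset) simp
  have "0 \<in> ?S" by (simp add: has_identity_submatrix_def)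
  then have "Max ?S \<in> ?S" using fin by (intro Max_in) auto
  then show ?thesis unfolding mim_def using has_identity_submatrix_le[OF assms] by blast
qed

lemma ereal_mimsup:
  assumes "finite R"
  shows "ereal (mimsup R C M) = limsup (\<lambda>k.
    ereal (real (mim (tuples k R) (tuples k C) (kron_power k M)) powr (1 / real k)))"
    (is "_ = limsup ?f")
proof -
  have bnd: "?f k \<le> ereal (real (card R))" if "k > 0" for k
  proof -
    have "mim (tuples k R) (tuples k C) (kron_power k M) \<le> card R ^ k"
      using mim_le[of "tuples k R"] finite_lists_length_eq[OF assms] card_lists_length_eq[OF assms]
      by (metis tuples_def)
    then have "real (mim (tuples k R) (tuples k C) (kron_power k M)) \<le> real (card R) ^ k"
      by (metis of_nat_le_iff of_nat_power)
    then have "real (mim (tuples k R) (tuples k C) (kron_power k M)) powr (1 / real k)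
      \<le> (real (card R) ^ k) powr (1 / real k)"
      by (intro powr_mono2) auto
    also have "\<dots> = real (card R)"
      using that by (cases "card R = 0") (auto simp flip: powr_realpow simp: powr_powr)
    finally show ?thesis by simp
  qed
  have "limsup ?f \<le> ereal (real (card R))"
    by (rule Limsup_bounded, rule eventually_mono[OF eventually_gt_at_top[of 0]]) (rule bnd)
  moreover have "0 \<le> limsup ?f"
  proof -
    have "0 \<le> liminf ?f" by (rule Liminf_bounded) auto
    then show ?thesis using Liminf_le_Limsup[of sequentially ?f] by (auto intro: order_trans)
  qed
  ultimately have "\<bar>limsup ?f\<bar> \<noteq> \<infinity>" by auto
  then show ?thesis unfolding mimsup_def by (simp add: ereal_real')
qed

end

theory Submission
  imports Defs
begin

text \<open>
  An inclusion-minimal representing subset has a private column for each of its rows, so it spans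
  an identity submatrix. Hence the worst-case size of a representing subset is exactly
  \<open>mim\<close> of the Kronecker power. Since \<open>mim\<close> is supermultiplicative under Kronecker products,
  Fekete's argument turns the limit superior into a limit and a supremum.
\<close>

section \<open>Identity submatrices given by a row set and a column choice\<close>

lemma has_identity_submatrixI:
  assumes "finite S" "S \<subseteq> R" "f ` S \<subseteq> C"
    and entries: "\<And>s t. s \<in> S \<Longrightarrow> t \<in> S \<Longrightarrow> M s (f t) = (if s = t then 1 else 0)"
  shows "has_identity_submatrix R C M (card S)"
proof -
  obtain row where row: "bij_betw row {..<card S} S"
    using ex_bij_betw_nat_finite[OF assms(1)] by (auto simp: atLeast0LessThan)
  have "inj_on f S"
    by (rule inj_onI) (metis entries zero_neq_one)
  with row have inj: "inj_on (f \<circ> row) {..<card S}"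
    by (simp add: bij_betw_def comp_inj_on)
  have "M (row i) ((f \<circ> row) j) = (if i = j then 1 else 0)" if "i < card S" "j < card S" for i j
  proof -
    have "row i \<in> S" "row j \<in> S" "row i = row j \<longleftrightarrow> i = j"
      using that row by (auto simp: bij_betw_def inj_on_eq_iff)
    then show ?thesis
      by (simp add: entries)
  qed
  then show ?thesis
    unfolding has_identity_submatrix_def
    using row inj assms(2,3)
    by (intro exI[of _ row] exI[of _ "f \<circ> row"])
      (simp add: bij_betw_def image_subset_iff, blast)
qed

text \<open>Indexing by a row set \<open>S\<close> and a map \<open>f\<close> from rows to columns
  avoids numbering: products of submatrices become products of row sets. Columns need no separate
  injectivity condition, since \<open>f s = f t\<close> with \<open>s\<close> and \<open>t\<close>
  distinct would make one entry both 0 and 1.\<close>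

lemma has_identity_submatrixE:
  assumes "has_identity_submatrix R C M n"
  obtains S f where "finite S" "S \<subseteq> R" "f ` S \<subseteq> C" "card S = n"
    "\<forall>s\<in>S. \<forall>t\<in>S. M s (f t) = (if s = t then 1 else 0)"
proof -
  from assms obtain row col where rc: "row ` {..<n} \<subseteq> R" "inj_on row {..<n}" "col ` {..<n} \<subseteq> C"
    "\<forall>i<n. \<forall>j<n. M (row i) (col j) = (if i = j then 1 else 0)"
    unfolding has_identity_submatrix_def by blast
  let ?f = "col \<circ> the_inv_into {..<n} row"
  show ?thesis
  proof (rule that[of "row ` {..<n}" ?f])
    show "?f ` row ` {..<n} \<subseteq> C"
      using rc(2,3) by (auto simp: the_inv_into_f_f)
    show "card (row ` {..<n}) = n"
      using rc(2) by (simp add: card_image)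
    show "\<forall>s\<in>row ` {..<n}. \<forall>t\<in>row ` {..<n}. M s (?f t) = (if s = t then 1 else 0)"
      using rc(2,4) by (auto simp: the_inv_into_f_f inj_on_def)
  qed (use rc(1) in auto)
qed

lemma finite_identity_submatrix_sizes:
  assumes "finite R"
  shows "finite {n. has_identity_submatrix R C M n}"
  by (rule finite_subset[of _ "{..card R}"]) (auto dest: has_identity_submatrix_le[OF assms])

lemma le_mim:
  assumes "finite R" "has_identity_submatrix R C M n"
  shows "n \<le> mim R C M"
  unfolding mim_def using assms finite_identity_submatrix_sizes by (intro Max_ge) auto

lemma has_identity_submatrix_mim:
  assumes "finite R"
  shows "has_identity_submatrix R C M (mim R C M)"
proof -
  have "0 \<in> {n. has_identity_submatrix R C M n}"
    by (simp add: has_identity_submatrix_def)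
  then have "Max {n. has_identity_submatrix R C M n} \<in> {n. has_identity_submatrix R C M n}"
    using finite_identity_submatrix_sizes[OF assms] by (intro Max_in) auto
  then show ?thesis
    by (simp add: mim_def)
qed

section \<open>Worst-case size of a representing subset\<close>

lemma representing_subset_le_mim:
  assumes "finite R" "A \<subseteq> R"
    and bin: "\<And>i j. M i j \<in> {0, 1}"
  shows "\<exists>A' \<subseteq> A. card A' \<le> mim R C M \<and> represents C M A' A"
proof -
  have "finite A"
    using assms finite_subset by blast
  have "represents C M A A"
    by (simp add: represents_def)
  then obtain B where B: "represents C M B A"
    and least: "\<And>B'. represents C M B' A \<Longrightarrow> card B \<le> card B'"
    using ex_has_least_nat[of "\<lambda>B. represents C M B A" A card] by blast
  have "B \<subseteq> A" "finite B"
    using B \<open>finite A\<close> finite_subset by (auto simp: represents_def)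
  \<comment> \<open>Least cardinality is used only against deletion of one row: some column met by
    \<open>A\<close> is then missed by \<open>B - {b}\<close>. Since \<open>B\<close> still meets
    it, \<open>b\<close> is its only row with entry 1 in \<open>B\<close>.\<close>
  have "\<exists>j\<in>C. M b j = 1 \<and> (\<forall>b'\<in>B - {b}. M b' j = 0)" if "b \<in> B" for b
  proof -
    have "card (B - {b}) < card B"
      using \<open>finite B\<close> that by (rule card_Diff1_less)
    then have "\<not> represents C M (B - {b}) A"
      using least by (meson not_le)
    then obtain j where j: "j \<in> C" "\<exists>i\<in>A. M i j = 1" "\<forall>i\<in>B - {b}. M i j \<noteq> 1"
      using \<open>B \<subseteq> A\<close> unfolding represents_def by blast
    then obtain i where "i \<in> B" "M i j = 1"
      using B unfolding represents_def by blast
    with j have "M b j = 1"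
      by (cases "i = b") auto
    moreover have "\<forall>b'\<in>B - {b}. M b' j = 0"
      using j(3) bin by blast
    ultimately show ?thesis
      using j(1) by blast
  qed
  then obtain f where f: "\<And>b. b \<in> B \<Longrightarrow> f b \<in> C \<and> M b (f b) = 1 \<and> (\<forall>b'\<in>B - {b}. M b' (f b) = 0)"
    by metis
  have "has_identity_submatrix R C M (card B)"
    by (rule has_identity_submatrixI[where f = f]) (use f \<open>finite B\<close> \<open>B \<subseteq> A\<close> assms(2) in auto)
  then show ?thesis
    using le_mim[OF assms(1)] B \<open>B \<subseteq> A\<close> by blast
qed

lemma mim_le_representing_subset:
  assumes "finite R"
  shows "\<exists>A \<subseteq> R. \<forall>A'. represents C M A' A \<longrightarrow> mim R C M \<le> card A'"
proof -
  obtain S f where S: "finite S" "S \<subseteq> R" "f ` S \<subseteq> C" "card S = mim R C M"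
    "\<forall>s\<in>S. \<forall>t\<in>S. M s (f t) = (if s = t then 1 else 0)"
    using has_identity_submatrix_mim[OF assms] by (rule has_identity_submatrixE)
  have "A' = S" if rep: "represents C M A' S" for A'
  proof
    show "A' \<subseteq> S"
      using rep by (simp add: represents_def)
    show "S \<subseteq> A'"
    proof
      fix s assume "s \<in> S"
      then have "f s \<in> C" "M s (f s) = 1"
        using S(3,5) by auto
      with \<open>s \<in> S\<close> rep obtain s' where "s' \<in> A'" "M s' (f s) = 1"
        unfolding represents_def by blast
      with \<open>A' \<subseteq> S\<close> \<open>s \<in> S\<close> S(5) show "s \<in> A'"
        by (metis subsetD zero_neq_one)
    qed
  qed
  then show ?thesis
    using S(2,4) by (metis order_refl)
qed

section \<open>Kronecker powers\<close>

lemma finite_tuples: "finite S \<Longrightarrow> finite (tuples k S)"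
  by (simp add: tuples_def finite_lists_length_eq)

lemma append_in_tuples: "xs \<in> tuples a S \<Longrightarrow> ys \<in> tuples b S \<Longrightarrow> xs @ ys \<in> tuples (a + b) S"
  by (auto simp: tuples_def)

lemma kron_power_append:
  assumes "length r = a" "length c = a"
  shows "kron_power (a + b) M (r @ r') (c @ c') = kron_power a M r c * kron_power b M r' c'"
  using assms unfolding kron_power_def
  by (induction b) (auto simp: nth_append mult_ac)

lemma kron_power_binary:
  assumes "\<And>i j. M i j \<in> {0, 1}"
  shows "kron_power k M r c \<in> {0, 1}"
proof (induction k)
  case (Suc k)
  then show ?case
    using assms[of "r ! k" "c ! k"] by (auto simp: kron_power_def)
qed (simp add: kron_power_def)

text \<open>Concatenate the rows and the columns of two optimal submatrices. The entry factors into
  the two old entries, hence is 1 exactly when both halves agree.\<close>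

lemma mim_kron_power_supermult:
  fixes R :: "'r set" and C :: "'c set" and M
  defines "m \<equiv> \<lambda>k. mim (tuples k R) (tuples k C) (kron_power k M)"
  assumes "finite R"
  shows "m a * m b \<le> m (a + b)"
proof -
  have ex: "has_identity_submatrix (tuples k R) (tuples k C) (kron_power k M) (m k)" for k
    unfolding m_def by (rule has_identity_submatrix_mim[OF finite_tuples[OF assms(2)]])
  obtain S f where S: "finite S" "S \<subseteq> tuples a R" "f ` S \<subseteq> tuples a C" "card S = m a"
    "\<forall>s\<in>S. \<forall>t\<in>S. kron_power a M s (f t) = (if s = t then 1 else 0)"
    using ex[of a] by (rule has_identity_submatrixE)
  obtain T g where T: "finite T" "T \<subseteq> tuples b R" "g ` T \<subseteq> tuples b C" "card T = m b"
    "\<forall>s\<in>T. \<forall>t\<in>T. kron_power b M s (g t) = (if s = t then 1 else 0)"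
    using ex[of b] by (rule has_identity_submatrixE)
  have len: "length s = a" "length (f s) = a" if "s \<in> S" for s
    using that S(2,3) by (auto simp: tuples_def)
  let ?U = "(\<lambda>(s, t). s @ t) ` (S \<times> T)"
  \<comment> \<open>All rows in \<open>S\<close> have length \<open>a\<close>, so cutting at
    \<open>a\<close> recovers the pair behind \<open>u\<close>; the same fact makes concatenation
    injective below.\<close>
  let ?h = "\<lambda>u. f (take a u) @ g (drop a u)"
  have "inj_on (\<lambda>(s, t). s @ t) (S \<times> T)"
    by (rule inj_onI) (auto simp: len)
  then have card: "card ?U = m a * m b"
    using S(4) T(4) by (simp add: card_image card_cartesian_product)
  have "has_identity_submatrix (tuples (a + b) R) (tuples (a + b) C) (kron_power (a + b) M) (card ?U)"
  proof (rule has_identity_submatrixI[where f = ?h])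
    show "finite ?U"
      using S(1) T(1) by simp
    show "?U \<subseteq> tuples (a + b) R"
      using S(2) T(2) by (auto intro!: append_in_tuples)
    show "?h ` ?U \<subseteq> tuples (a + b) C"
      using S(3) T(3) by (auto simp: len intro!: append_in_tuples)
    show "kron_power (a + b) M u (?h v) = (if u = v then 1 else 0)" if "u \<in> ?U" "v \<in> ?U" for u v
      using that S(5) T(5) by (auto simp: len kron_power_append)
  qed
  then show ?thesis
    unfolding card unfolding m_def by (rule le_mim[OF finite_tuples[OF assms(2)]])
qed

text \<open>Constant tuples over a single 1-entry form a 1 by 1 identity. This supplies the
  positivity that the limit argument below assumes.\<close>

lemma mim_kron_power_pos:
  assumes "finite R" "u \<in> R" "v \<in> C" "M u v = 1"
  shows "0 < mim (tuples k R) (tuples k C) (kron_power k M)"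
proof -
  have "has_identity_submatrix (tuples k R) (tuples k C) (kron_power k M) (card {replicate k u})"
    by (rule has_identity_submatrixI[where f = "\<lambda>_. replicate k v"])
      (use assms in \<open>auto simp: tuples_def kron_power_def\<close>)
  then show ?thesis
    using le_mim[OF finite_tuples[OF assms(1)]] by fastforce
qed

section \<open>Fekete's argument for positive supermultiplicative sequences\<close>

context
  fixes f :: "nat \<Rightarrow> nat" and L :: real
  assumes supermult: "\<And>a b. f a * f b \<le> f (a + b)"
    and pos: "\<And>k. 0 < f k"
    and L: "ereal L = limsup (\<lambda>k. ereal (real (f k) powr (1 / real k)))"
begin

text \<open>The summand \<open>r\<close> serves as the remainder of a division by \<open>m\<close>;
  its factor \<open>f r\<close> is at least 1 and can be discarded.\<close>

lemma supermult_power_le: "f m ^ q \<le> f (q * m + r)"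
proof (induction q)
  case 0
  then show ?case
    using pos[of r] by simp
next
  case (Suc q)
  then have "f m * f m ^ q \<le> f m * f (q * m + r)"
    by simp
  also have "\<dots> \<le> f (m + (q * m + r))"
    by (rule supermult)
  finally show ?case
    by (simp add: add.assoc)
qed

lemma root_power: "0 < m \<Longrightarrow> (real (f m) powr (1 / real m)) ^ m = real (f m)"
  using pos[of m] by (simp add: powr_powr flip: powr_realpow)

text \<open>The root at \<open>k\<close> is at most the root at every positive multiple of
  \<open>k\<close>, so the limit superior along these multiples, and hence \<open>L\<close>, is at
  least the root at \<open>k\<close>.\<close>

lemma supermult_le_limsup_power: "real (f k) \<le> L ^ k"
proof (cases "k = 0")
  case True
  \<comment> \<open>At index 0 the exponent \<open>1 / 0\<close> is 0 and roots say nothing about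
    \<open>f 0\<close>, so supermultiplicativity is used directly.\<close>
  have "f 0 * f 0 \<le> f 0 * 1"
    using supermult[of 0 0] by simp
  with pos[of 0] have "f 0 \<le> 1"
    by (simp only: mult_le_cancel1)
  with True show ?thesis
    by simp
next
  case False
  let ?g = "\<lambda>k. real (f k) powr (1 / real k)"
  have "?g k \<le> ?g (n * k)" if "0 < n" for n
  proof -
    have "real (f k) ^ n \<le> real (f (n * k))"
      using supermult_power_le[of k n 0] by (simp flip: of_nat_power)
    then have "(real (f k) ^ n) powr (1 / real (n * k)) \<le> ?g (n * k)"
      by (intro powr_mono2) auto
    moreover have "(real (f k) ^ n) powr (1 / real (n * k)) = ?g k"
      using that pos[of k] by (simp add: powr_powr flip: powr_realpow)
    ultimately show ?thesis
      by simp
  qed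
  then have ge: "?g k \<le> ?g (Suc n * k)" for n
    by blast
  \<comment> \<open>\<open>Suc n\<close> keeps every multiple positive, and strict monotonicity
    makes this a genuine subsequence.\<close>
  have "strict_mono (\<lambda>n. Suc n * k)"
    using False by (auto simp: strict_mono_def)
  then have "limsup ((\<lambda>k. ereal (?g k)) \<circ> (\<lambda>n. Suc n * k)) \<le> ereal L"
    unfolding L by (rule limsup_subseq_mono)
  moreover have "ereal (?g k) \<le> limsup ((\<lambda>k. ereal (?g k)) \<circ> (\<lambda>n. Suc n * k))"
    by (rule le_Limsup) (use ge in \<open>auto intro!: always_eventually\<close>)
  ultimately have "?g k \<le> L"
    using order_trans by fastforce
  then have "?g k ^ k \<le> L ^ k"
    by (intro power_mono) auto
  then show ?thesis
    using root_power False by simp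
qed

text \<open>One index \<open>m\<close> whose root \<open>a\<close> exceeds \<open>c\<close> controls
  all large \<open>n\<close>: division by \<open>m\<close> gives \<open>f n\<close> at least
  \<open>a ^ n / f m\<close>, and the fixed loss \<open>f m\<close> is outgrown by
  \<open>(a / c) ^ n\<close>.\<close>

lemma eventually_power_less_supermult:
  assumes "0 \<le> c" "c < L"
  shows "\<forall>\<^sub>F n in sequentially. c ^ n < real (f n)"
proof (cases "c = 0")
  case True
  \<comment> \<open>Index 0 is excluded because \<open>0 ^ 0 = 1\<close>.\<close>
  show ?thesis
    using eventually_gt_at_top[of 0] by eventually_elim (simp add: True pos zero_power)
next
  case False
  with assms have "0 < c"
    by simp
  \<comment> \<open>Otherwise \<open>c\<close> would bound every root of positive index, and so the
    limit superior \<open>L\<close>.\<close>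
  have "\<exists>m>0. c < real (f m) powr (1 / real m)"
  proof (rule ccontr)
    assume "\<not> ?thesis"
    then have *: "real (f m) powr (1 / real m) \<le> c" if "0 < m" for m
      using that by (meson not_le)
    have "limsup (\<lambda>k. ereal (real (f k) powr (1 / real k))) \<le> ereal c"
      by (rule Limsup_bounded, rule eventually_mono[OF eventually_gt_at_top[of 0]])
        (simp add: *)
    with assms(2) show False
      by (simp flip: L)
  qed
  then obtain m where m: "0 < m" "c < real (f m) powr (1 / real m)"
    by blast
  define a where "a = real (f m) powr (1 / real m)"
  have "1 \<le> real (f m)"
    using pos[of m] by linarith
  then have "1 \<le> a"
    unfolding a_def by (intro ge_one_powr_ge_zero) auto
  have "1 < a / c"
    using m \<open>0 < c\<close> by (simp add: a_def)
  then obtain N where N: "real (f m) < (a / c) ^ N"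
    using real_arch_pow by blast
  show ?thesis
    using eventually_ge_at_top[of N]
  proof eventually_elim
    case (elim n)
    define q where "q = n div m"
    have n: "q * m + n mod m = n"
      by (simp add: q_def)
    then have "n \<le> q * m + m"
      using mod_less_divisor[OF m(1), of n] by linarith
    have "real (f m) < (a / c) ^ n"
      using N power_increasing[OF elim, of "a / c"] \<open>1 < a / c\<close> by linarith
    then have "c ^ n * real (f m) < a ^ n"
      using \<open>0 < c\<close> by (simp add: power_divide field_simps)
    \<comment> \<open>Rounding \<open>n\<close> up to the next multiple of \<open>m\<close> is
      harmless as \<open>a\<close> is at least 1; the extra factor \<open>a ^ m\<close> is exactly
      \<open>f m\<close> and cancels at the end.\<close>
    also have "a ^ n \<le> a ^ (q * m + m)"
      using \<open>n \<le> q * m + m\<close> \<open>1 \<le> a\<close> by (rule power_increasing)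
    also have "\<dots> = real (f m ^ q) * real (f m)"
      using root_power[OF m(1)] by (simp add: a_def power_add power_mult mult.commute[of q m])
    also have "\<dots> \<le> real (f n) * real (f m)"
      using supermult_power_le[of m q "n mod m"] by (intro mult_right_mono) (simp_all only: n of_nat_le_iff of_nat_0_le_iff)
    finally show ?case
      using pos[of m] by simp
  qed
qed

end

section \<open>Application to non-bipartite graphs\<close>

lemma non_bipartite_has_edge:
  assumes "\<not> bipartite H"
  obtains u v where "(u, v) \<in> parcs H"
proof -
  have "parcs H \<noteq> {}"
  proof
    assume "parcs H = {}"
    then have "bipartite H"
      \<comment> \<open>Without arcs, the whole vertex set and the empty set form a
        bipartition.\<close>
      unfolding bipartite_def by (intro exI[of _ "pverts H"] exI[of _ "{}"]) simp
    with assms show False ..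
  qed
  then show ?thesis
    using that by fast
qed

theorem theorem6:
  fixes H :: "'a pair_pre_digraph" and h :: nat
  assumes "pair_graph H"
    and "\<not> bipartite H"
    and "card (pverts H) = h"
  shows
    "(\<forall>k::nat. \<forall>A \<subseteq> tuples k (pverts H).
        \<exists>A' \<subseteq> A. real (card A') \<le> graph_mimsup H ^ k \<and>
          represents (tuples k (pverts H)) (kron_power k (adj_matrix H)) A' A) \<and>
     (\<forall>\<epsilon>::real. \<epsilon> > 0 \<longrightarrow>
        (\<forall>\<^sub>F k in sequentially. \<exists>A \<subseteq> tuples k (pverts H).
          \<not> (\<exists>A' \<subseteq> A. real (card A') \<le> (max 0 (graph_mimsup H - \<epsilon>)) ^ k \<and>
            represents (tuples k (pverts H)) (kron_power k (adj_matrix H)) A' A)))"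
proof -
  interpret pair_graph H
    by (rule assms(1))
  let ?V = "pverts H"
  let ?M = "adj_matrix H"
  let ?m = "\<lambda>k. mim (tuples k ?V) (tuples k ?V) (kron_power k ?M)"
  let ?rep = "\<lambda>k. represents (tuples k ?V) (kron_power k ?M)"
  have fin: "finite (tuples k ?V)" for k
    by (simp add: finite_tuples)
  obtain u v where "(u, v) \<in> parcs H"
    using non_bipartite_has_edge[OF assms(2)] .
  then have pos: "0 < ?m k" for k
    by (intro mim_kron_power_pos[of _ u v]) (auto simp: adj_matrix_def dest: in_arcsD1 in_arcsD2)
  have supermult: "?m a * ?m b \<le> ?m (a + b)" for a b
    by (rule mim_kron_power_supermult) simp
  have L: "ereal (graph_mimsup H) = limsup (\<lambda>k. ereal (real (?m k) powr (1 / real k)))"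
    unfolding graph_mimsup_def by (rule ereal_mimsup) simp
  have "\<exists>A' \<subseteq> A. real (card A') \<le> graph_mimsup H ^ k \<and> ?rep k A' A"
    if "A \<subseteq> tuples k ?V" for k A
  proof -
    have "kron_power k ?M i j \<in> {0, 1}" for i j
      by (rule kron_power_binary) (simp add: adj_matrix_def)
    then obtain A' where "A' \<subseteq> A" "card A' \<le> ?m k" "?rep k A' A"
      using representing_subset_le_mim[OF fin \<open>A \<subseteq> tuples k ?V\<close>, of "kron_power k ?M" "tuples k ?V"]
      by blast
    moreover have "real (?m k) \<le> graph_mimsup H ^ k"
      by (rule supermult_le_limsup_power[where f = ?m, OF supermult pos L])
    ultimately show ?thesis
      by (meson of_nat_mono order_trans)
  qed
  moreover have "\<forall>\<^sub>F k in sequentially. \<exists>A \<subseteq> tuples k ?V.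
      \<not> (\<exists>A' \<subseteq> A. real (card A') \<le> (max 0 (graph_mimsup H - \<epsilon>)) ^ k \<and> ?rep k A' A)"
    if "\<epsilon> > 0" for \<epsilon> :: real
  proof -
    \<comment> \<open>Since \<open>graph_mimsup H\<close> is positive, the clamped base
      \<open>max 0 (graph_mimsup H - \<epsilon>)\<close> lies strictly below it even for large
      \<epsilon>. The clamp keeps even powers of a negative base from becoming large.\<close>
    have "1 \<le> graph_mimsup H"
      using supermult_le_limsup_power[where f = ?m and k = 1, OF supermult pos L] pos[of 1]
      by simp
    then have "\<forall>\<^sub>F k in sequentially. (max 0 (graph_mimsup H - \<epsilon>)) ^ k < real (?m k)"
      using that
      by (intro eventually_power_less_supermult[where f = ?m, OF supermult pos L]) auto
    then show ?thesis
    proof eventually_elim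
      case (elim k)
      obtain A where A: "A \<subseteq> tuples k ?V" "\<And>A'. ?rep k A' A \<Longrightarrow> ?m k \<le> card A'"
        using mim_le_representing_subset[OF fin] by metis
      then have "(max 0 (graph_mimsup H - \<epsilon>)) ^ k < real (card A')" if "?rep k A' A" for A'
        using elim that by (meson less_le_trans of_nat_mono)
      with A(1) show ?case
        by (meson not_le)
    qed
  qed
  ultimately show ?thesis
    by blast
qed

end
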